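(* If $G$ is a finite simple undirected $P_6$-free graph that has an efficient dominating set, then its square $G^2$ is $C_k$-free for every $k\ge 5$.
   Context: All graphs are finite, undirected and simple. A vertex dominates itself and its neighbors. A set $D\subseteq V$ is an efficient dominating set of $G=(V,E)$ if every vertex of $G$ is dominated by exactly one vertex of $D$. The square $G^2=(V,E^2)$ has $uv\in E^2$ iff $d_G(u,v)\in\{1,2\}$. "$F$-free" means containing no induced subgraph isomorphic to $F$. $P_k$ (resp. $C_k$) is the chordless path (resp. cycle) on $k$ vertices. *)

theory Defs
  imports "Graph_Theory.Graph_Theory"
begin

text \<open>
  Finite simple undirected graphs are the members of the locale \<^locale>\<open>pair_graph\<close>:
  finite, loop-free, symmetric digraphs without parallel arcs. Each undirected edge is
  represented by its two orientations.
\<close>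

definition dominates :: "'a pair_pre_digraph \<Rightarrow> 'a \<Rightarrow> 'a \<Rightarrow> bool" where
  "dominates G u v \<longleftrightarrow> u = v \<or> (u, v) \<in> parcs G"

definition efficient_dominating_set :: "'a pair_pre_digraph \<Rightarrow> 'a set \<Rightarrow> bool" where
  "efficient_dominating_set G D \<longleftrightarrow>
     D \<subseteq> pverts G \<and> (\<forall>v \<in> pverts G. \<exists>!d. d \<in> D \<and> dominates G d v)"

text \<open>
  With unit weights, \<^const>\<open>wf_digraph.\<mu>\<close> is the length of a shortest walk, with value
  \<open>\<infinity>\<close> if there is none.
\<close>

definition graph_distance :: "'a pair_pre_digraph \<Rightarrow> 'a \<Rightarrow> 'a \<Rightarrow> ereal" where
  "graph_distance G u v = wf_digraph.\<mu> (with_proj G) (\<lambda>_. 1) u v"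

definition square_graph :: "'a pair_pre_digraph \<Rightarrow> 'a pair_pre_digraph" where
  "square_graph G =
     \<lparr> pverts = pverts G,
       parcs = {(u, v). u \<in> pverts G \<and> v \<in> pverts G \<and> graph_distance G u v \<in> {1, 2}} \<rparr>"

definition induced_free :: "'b pair_pre_digraph \<Rightarrow> 'a pair_pre_digraph \<Rightarrow> bool" where
  "induced_free F G \<longleftrightarrow>
     \<not> (\<exists>H. induced_subgraph H (with_proj G) \<and> digraph_iso H (with_proj F))"

definition path_graph :: "nat \<Rightarrow> nat pair_pre_digraph" where
  "path_graph k =
     \<lparr> pverts = {..<k},
       parcs = {(i, j). i < k \<and> j < k \<and> (j = i + 1 \<or> i = j + 1)} \<rparr>"

text \<open>Only meaningful as a simple cycle for \<open>k \<ge> 3\<close>.\<close>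

definition cycle_graph :: "nat \<Rightarrow> nat pair_pre_digraph" where
  "cycle_graph k =
     \<lparr> pverts = {..<k},
       parcs = {(i, j). i < k \<and> j < k \<and> (j = (i + 1) mod k \<or> i = (j + 1) mod k)} \<rparr>"

end

theory Submission
  imports Defs
begin

text \<open>
  Write \<open>N\<close> for closed adjacency. Six vertices induce a \<open>P\<^sub>6\<close> as soon as consecutive ones are
  \<open>N\<close>-related and nonconsecutive ones are not: they are then automatically distinct. If \<open>\<delta> u\<close>
  is the unique dominator of \<open>u\<close>, then \<open>\<delta> u\<close> is \<open>N\<close>-related to \<open>w\<close> iff \<open>\<delta> u = \<delta> w\<close>,
  so vertices inside the efficient dominating set need no special treatment.

  An induced cycle of the square is a sequence \<open>v i\<close> with midpoints \<open>m i\<close>, where \<open>v i\<close> and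
  \<open>v (i + 1)\<close> are both \<open>N\<close>-related to \<open>m i\<close>, and nonconsecutive \<open>v i\<close>, \<open>v j\<close> have disjoint
  closed neighbourhoods. Excluding induced \<open>P\<^sub>6\<close>s among the \<open>v i\<close>, the \<open>m i\<close> and their
  dominators shows in turn that consecutive \<open>v i\<close> are nonadjacent, that they have distinct
  dominators, and that this is impossible. For \<open>k \<ge> 6\<close> six consecutive cycle vertices suffice,
  whatever the relation between the first and the last of them; \<open>k = 5\<close> needs its own choice of paths.
\<close>

section \<open>Induced copies as vertex embeddings, and distances in the square\<close>

text \<open>Arcs are pairs with \<open>fst\<close> and \<open>snd\<close> as end maps on both sides,
  so an isomorphism is determined by its action on vertices. This allows induced paths and cycles to
  be handled as maps on indices.\<close>

lemma not_induced_free_iff: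
  fixes F :: "'b pair_pre_digraph" and G :: "'a pair_pre_digraph"
  assumes "pair_wf_digraph F" and "pair_wf_digraph G"
  shows "\<not> induced_free F G \<longleftrightarrow> (\<exists>f. inj_on f (pverts F) \<and> f ` pverts F \<subseteq> pverts G \<and>
    (\<forall>x\<in>pverts F. \<forall>y\<in>pverts F. (x, y) \<in> parcs F \<longleftrightarrow> (f x, f y) \<in> parcs G))"
    (is "?L \<longleftrightarrow> ?R")
proof
  assume ?L
  then obtain H h where H: "induced_subgraph H (with_proj G)"
    and h: "pre_digraph.digraph_isomorphism H h" and F: "with_proj F = app_iso h H"
    by (auto simp: induced_free_def digraph_iso_def)
  have H_simps: "verts H \<subseteq> pverts G" "tail H = fst" "head H = snd"
    "arcs H = {e \<in> parcs G. fst e \<in> verts H \<and> snd e \<in> verts H}"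
    using H by (auto simp: induced_subgraph_def subgraph_def compatible_def)
  have inj: "inj_on (iso_verts h) (verts H)"
    and arc: "\<And>a. a \<in> arcs H \<Longrightarrow>
      iso_verts h (fst a) = iso_tail h (iso_arcs h a) \<and> iso_verts h (snd a) = iso_head h (iso_arcs h a)"
    using h H_simps by (auto simp: pre_digraph.digraph_isomorphism_def)
  have F_simps: "pverts F = iso_verts h ` verts H" "parcs F = iso_arcs h ` arcs H"
    "iso_tail h = fst" "iso_head h = snd"
    using F by (simp_all add: with_proj_def app_iso_def)
  \<comment> \<open>\<open>iso_arcs\<close> is a separate component of \<open>h\<close>;
    compatibility with the end maps forces it to send a pair to the pair of vertex images.\<close>
  have arcs_iff: "(iso_verts h x, iso_verts h y) \<in> parcs F \<longleftrightarrow> (x, y) \<in> parcs G"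
    if xy: "x \<in> verts H" "y \<in> verts H" for x y
  proof
    assume "(iso_verts h x, iso_verts h y) \<in> parcs F"
    then obtain a where a: "a \<in> arcs H" "iso_arcs h a = (iso_verts h x, iso_verts h y)"
      using F_simps by auto
    then have "iso_verts h (fst a) = iso_verts h x" "iso_verts h (snd a) = iso_verts h y"
      using arc F_simps by auto
    then have "a = (x, y)"
      using inj xy a H_simps by (metis (mono_tags, lifting) inj_onD mem_Collect_eq prod.collapse)
    then show "(x, y) \<in> parcs G"
      using a H_simps by auto
  next
    assume "(x, y) \<in> parcs G"
    then have a: "(x, y) \<in> arcs H"
      using xy H_simps by auto
    then have "iso_arcs h (x, y) = (iso_verts h x, iso_verts h y)"
      using arc[OF a] F_simps by (simp add: prod_eq_iff)
    then show "(iso_verts h x, iso_verts h y) \<in> parcs F"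
      using a F_simps by (metis image_eqI)
  qed
  \<comment> \<open>\<open>h\<close> leads from the subgraph to \<open>F\<close>, so the embedding
    is its inverse on vertices.\<close>
  let ?f = "the_inv_into (verts H) (iso_verts h)"
  have f: "bij_betw ?f (pverts F) (verts H)"
    using inj F_simps by (simp add: bij_betw_imageI bij_betw_the_inv_into)
  have f_verts: "?f x \<in> verts H" "iso_verts h (?f x) = x" if "x \<in> pverts F" for x
    using bij_betwE[OF f] that inj F_simps(1) by (auto simp: f_the_inv_into_f)
  have "(x, y) \<in> parcs F \<longleftrightarrow> (?f x, ?f y) \<in> parcs G" if "x \<in> pverts F" "y \<in> pverts F" for x y
    using arcs_iff[OF f_verts(1) f_verts(1), OF that] by (simp add: f_verts(2) that)
  moreover have "?f ` pverts F \<subseteq> pverts G"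
    using f H_simps by (auto simp: bij_betw_def)
  ultimately show ?R
    using bij_betw_imp_inj_on[OF f] by (intro exI[of _ ?f]) blast
next
  assume ?R
  then obtain f where f: "inj_on f (pverts F)" "f ` pverts F \<subseteq> pverts G"
    and arc: "\<And>x y. x \<in> pverts F \<Longrightarrow> y \<in> pverts F \<Longrightarrow> (x, y) \<in> parcs F \<longleftrightarrow> (f x, f y) \<in> parcs G"
    by blast
  interpret G: pair_wf_digraph G by fact
  interpret F: pair_wf_digraph F by fact
  let ?H = "with_proj G \<restriction> (f ` pverts F)"
  let ?g = "the_inv_into (pverts F) f"
  let ?h = "\<lparr> iso_verts = ?g, iso_arcs = map_prod ?g ?g, iso_head = snd, iso_tail = fst \<rparr>"
  have g: "?g (f x) = x" if "x \<in> pverts F" for x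
    using f that by (simp add: the_inv_into_f_f)
  have arcs_H: "arcs ?H = map_prod f f ` parcs F"
  proof -
    have "e \<in> map_prod f f ` parcs F" if "e \<in> arcs ?H" for e
    proof -
      obtain x y where "x \<in> pverts F" "y \<in> pverts F" "e = (f x, f y)" "e \<in> parcs G"
        using \<open>e \<in> arcs ?H\<close> by (cases e) (auto simp: induce_subgraph_def)
      then show ?thesis using arc by auto
    qed
    moreover have "e \<in> arcs ?H" if e: "e \<in> map_prod f f ` parcs F" for e
    proof -
      obtain x y where xy: "(x, y) \<in> parcs F" "e = (f x, f y)"
        using e by (rule prod_fun_imageE)
      then have "x \<in> pverts F" "y \<in> pverts F"
        using F.in_arcsD1 F.in_arcsD2 by blast+
      then show ?thesis
        using xy arc[of x y] by (simp add: induce_subgraph_def)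
    qed
    ultimately show ?thesis by blast
  qed
  have arc_inv: "map_prod ?g ?g (map_prod f f e) = e" if "e \<in> parcs F" for e
    using that g F.in_arcsD1 F.in_arcsD2 by (cases e) simp
  then have arcs_inv: "map_prod ?g ?g ` arcs ?H = parcs F"
    unfolding arcs_H by (simp add: image_image cong: image_cong)
  have verts_inv: "?g ` f ` pverts F = pverts F"
    using g by (simp add: image_image cong: image_cong)
  have inj: "inj_on ?g (f ` pverts F)"
    using f(1) by (rule inj_on_the_inv_into)
  have "inj_on (map_prod ?g ?g) (arcs ?H)"
    by (rule inj_on_subset[OF map_prod_inj_on[OF inj inj]]) (auto simp: induce_subgraph_def)
  with inj have "pre_digraph.digraph_isomorphism ?H ?h"
    unfolding pre_digraph.digraph_isomorphism_def
    using G.wellformed_induce_subgraph by simp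
  moreover have "with_proj F = app_iso ?h ?H"
    using arcs_inv verts_inv by (simp add: with_proj_def app_iso_def)
  moreover have "induced_subgraph ?H (with_proj G)"
    using f by (intro G.induced_induce) auto
  ultimately show ?L
    unfolding induced_free_def digraph_iso_def by blast
qed

lemma pair_wf_path_graph: "pair_wf_digraph (path_graph k)"
  by unfold_locales (auto simp: path_graph_def)

lemma pair_wf_cycle_graph: "pair_wf_digraph (cycle_graph k)"
  by unfold_locales (auto simp: cycle_graph_def)

lemma pair_wf_square_graph: "pair_wf_digraph (square_graph G)"
  by unfold_locales (auto simp: square_graph_def)

text \<open>With unit weights the distance is an infimum of walk lengths, so a value below 3 is
  witnessed by a walk with at most two arcs.\<close>

lemma (in pair_wf_digraph) graph_distance_1_2_iff:
  assumes "u \<in> pverts G" and "v \<in> pverts G"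
  shows "graph_distance G u v \<in> {1, 2} \<longleftrightarrow>
    u \<noteq> v \<and> ((u, v) \<in> parcs G \<or> (\<exists>w. (u, w) \<in> parcs G \<and> (w, v) \<in> parcs G))"
proof -
  have cost: "awalk_cost (\<lambda>_. 1) p = real (length p)" for p :: "('a \<times> 'a) list"
    by (induct p) auto
  have dist: "graph_distance G u v = (INF p\<in>{p. awalk u p v}. ereal (real (length p)))"
    unfolding graph_distance_def \<mu>_def cost ..
  have short: "u = v \<or> (u, v) \<in> parcs G \<or> (\<exists>w. (u, w) \<in> parcs G \<and> (w, v) \<in> parcs G)"
    if "awalk u p v" "length p \<le> 2" for p
  proof -
    from that(2) consider "p = []" | e where "p = [e]" | e e' where "p = [e, e']"
      by (cases p; cases "tl p") auto
    then show ?thesis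
      by cases (use that(1) in \<open>auto simp: awalk_simps\<close>)
  qed
  show ?thesis
  proof
    assume d: "graph_distance G u v \<in> {1, 2}"
    then have "graph_distance G u v < ereal 3" by auto
    then obtain p where "awalk u p v" "length p < 3"
      unfolding dist INF_less_iff by auto
    then have "u = v \<or> (u, v) \<in> parcs G \<or> (\<exists>w. (u, w) \<in> parcs G \<and> (w, v) \<in> parcs G)"
      using short[of p] by simp
    moreover have "u \<noteq> v"
    proof
      assume "u = v"
      then have "awalk u [] v" using assms by (simp add: awalk_simps)
      then have "graph_distance G u v \<le> ereal (real (length []))"
        unfolding dist by (intro INF_lower2[of "[]"]) auto
      then show False using d by auto
    qed
    ultimately show "u \<noteq> v \<and> ((u, v) \<in> parcs G \<or> (\<exists>w. (u, w) \<in> parcs G \<and> (w, v) \<in> parcs G))"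
      by blast
  next
    assume r: "u \<noteq> v \<and> ((u, v) \<in> parcs G \<or> (\<exists>w. (u, w) \<in> parcs G \<and> (w, v) \<in> parcs G))"
    show "graph_distance G u v \<in> {1, 2}"
    proof (cases "(u, v) \<in> parcs G")
      case True
      then have "awalk u [(u, v)] v" using assms by (simp add: awalk_simps)
      moreover have "1 \<le> length p" if "awalk u p v" for p
        using that r by (cases p) (auto simp: awalk_simps)
      ultimately have "graph_distance G u v = 1"
        unfolding dist by (intro antisym INF_lower2[of "[(u, v)]"] INF_greatest) auto
      then show ?thesis by simp
    next
      case False
      with r obtain w where "(u, w) \<in> parcs G" "(w, v) \<in> parcs G" by blast
      then have "awalk u [(u, w), (w, v)] v" using assms by (simp add: awalk_simps)
      moreover have "2 \<le> length p" if "awalk u p v" for p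
        using that r False by (cases p; cases "tl p") (auto simp: awalk_simps)
      ultimately have "graph_distance G u v = 2"
        unfolding dist
        by (intro antisym INF_lower2[of "[(u, w), (w, v)]"] INF_greatest) auto
      then show ?thesis by simp
    qed
  qed
qed

section \<open>Closed adjacency with unique dominators\<close>

text \<open>The axioms range over the whole type, so the path arguments carry no vertex membership
  conditions. \<open>N_dom\<close> encodes efficiency.\<close>

locale P6_free_dominated =
  fixes N :: "'a \<Rightarrow> 'a \<Rightarrow> bool" and \<delta> :: "'a \<Rightarrow> 'a"
  assumes N_refl [simp]: "N x x"
    and N_sym: "N x y \<Longrightarrow> N y x"
    and N_dom [simp]: "N (\<delta> u) w \<longleftrightarrow> \<delta> u = \<delta> w"
    and no_P6: "\<lbrakk>N a b; N b c; N c d; N d e; N e f;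
      \<not> N a c; \<not> N a d; \<not> N a e; \<not> N a f; \<not> N b d; \<not> N b e; \<not> N b f;
      \<not> N c e; \<not> N c f; \<not> N d f\<rbrakk> \<Longrightarrow> False"
begin

lemma N_commute: "N x y \<longleftrightarrow> N y x"
  using N_sym by blast

lemma not_N_sym: "\<not> N x y \<Longrightarrow> \<not> N y x"
  using N_sym by blast

lemma N_dom_right [simp]: "N w (\<delta> u) \<longleftrightarrow> \<delta> w = \<delta> u"
  by (metis N_commute N_dom)

lemma dom_dom [simp]: "\<delta> (\<delta> u) = \<delta> u"
  by (metis N_dom N_refl)

text \<open>Distance at least 3: since \<open>N\<close> is reflexive, \<open>z\<close> may be an
  end, which also excludes equal and adjacent vertices.\<close>

definition far :: "'a \<Rightarrow> 'a \<Rightarrow> bool" where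
  "far x y \<longleftrightarrow> (\<forall>z. \<not> (N x z \<and> N z y))"

lemma far_commute: "far x y \<longleftrightarrow> far y x"
  unfolding far_def using N_commute by blast

lemma far_not_adj: "far x y \<Longrightarrow> \<not> N x y"
  unfolding far_def using N_refl by blast

text \<open>A common dominator would be a common closed neighbour.\<close>

lemma far_dom: "far x y \<Longrightarrow> \<delta> x \<noteq> \<delta> y"
  unfolding far_def by (metis N_dom N_dom_right)

lemma far_mid: "far x y \<Longrightarrow> N x z \<Longrightarrow> \<not> N y z"
  unfolding far_def using N_commute by blast

end

section \<open>Six consecutive vertices of a cycle in the square\<close>

text \<open>
  The candidate paths below were selected with a SAT solver so that the resulting disjunctions
  are jointly contradictory. In \<open>consecutive_dom_neq\<close> the common dominator \<open>\<delta> v3\<close> takes the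
  place of the midpoint \<open>m2\<close>.
\<close>

locale square_path = P6_free_dominated +
  fixes v0 v1 v2 v3 v4 v5 m0 m1 m2 m3 m4
  assumes far: "far v0 v2" "far v0 v3" "far v0 v4" "far v1 v3" "far v1 v4" "far v1 v5"
      "far v2 v4" "far v2 v5" "far v3 v5"
    and link: "N v0 m0" "N m0 v1" "N v1 m1" "N m1 v2" "N v2 m2" "N m2 v3" "N v3 m3" "N m3 v4"
      "N v4 m4" "N m4 v5"
begin

text \<open>Every vertex other than the two ends of a midpoint is far from at least one of these
  ends.\<close>

lemma not_adj_mid:
  shows "\<not> N v2 m0" "\<not> N v3 m0" "\<not> N v4 m0" "\<not> N v5 m0" "\<not> N v0 m1"
      "\<not> N v3 m1" "\<not> N v4 m1" "\<not> N v5 m1" "\<not> N v0 m2" "\<not> N v1 m2"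
      "\<not> N v4 m2" "\<not> N v5 m2" "\<not> N v0 m3" "\<not> N v1 m3" "\<not> N v2 m3"
      "\<not> N v5 m3" "\<not> N v0 m4" "\<not> N v1 m4" "\<not> N v2 m4" "\<not> N v3 m4"
  using far link far_mid N_sym far_commute by metis+

lemmas adjacency [simp] =
  far[THEN far_not_adj] far[THEN far_commute[THEN iffD1], THEN far_not_adj]
  far[THEN far_dom] far[THEN far_dom, symmetric]
  link link[THEN N_sym] not_adj_mid not_adj_mid[THEN not_N_sym]

lemma consecutive_not_adj: "\<not> N v1 v2"
proof
  assume d: "N v1 v2"
  \<comment> \<open>A second edge next to \<open>v1 v2\<close> would give \<open>v0\<close>,
    \<open>v2\<close> or \<open>v1\<close>, \<open>v3\<close> a common neighbour.\<close>
  have n [simp]: "\<not> N v0 v1" "\<not> N v1 v0" "\<not> N v2 v3" "\<not> N v3 v2"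
    using d far link far_mid N_commute by metis+
  \<comment> \<open>On the named path only the pair \<open>m0\<close>, \<open>m2\<close> is
    undetermined, so excluding the path forces this adjacency. Each later disjunction likewise lists
    how the undetermined pairs of its path can fail; pairs involving a dominator become equations by
    \<open>N_dom\<close>.\<close>
  have p1 [simp]: "N m0 m2"
    by (rule ccontr, rule no_P6[of v0 m0 v1 v2 m2 v3])
      (use d far[THEN far_dom] in \<open>auto simp: N_commute\<close>)
  have p2: "\<delta> m2 \<noteq> \<delta> v4 \<or> \<delta> m0 = \<delta> v1 \<or> \<delta> m2 = \<delta> v1 \<or> \<delta> m0 = \<delta> v4"
    by (rule ccontr, rule no_P6[of v4 "\<delta> v4" m2 m0 v1 "\<delta> v1"])
      (use d far[THEN far_dom] in \<open>auto simp: N_commute\<close>)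
  have p3: "\<delta> m0 = \<delta> v1 \<or> \<delta> m2 = \<delta> v1 \<or> \<delta> m0 = \<delta> v3 \<or> \<delta> m2 = \<delta> v3"
    by (rule ccontr, rule no_P6[of "\<delta> v1" v1 m0 m2 v3 "\<delta> v3"])
      (use d far[THEN far_dom] in \<open>auto simp: N_commute\<close>)
  have p4: "\<delta> m2 \<noteq> \<delta> v4 \<or> \<delta> m0 = \<delta> v0 \<or> \<delta> m2 = \<delta> v0 \<or> \<delta> m0 = \<delta> m2"
    by (rule ccontr, rule no_P6[of "\<delta> v0" v0 m0 m2 "\<delta> m2" v4])
      (use d far[THEN far_dom] in \<open>auto simp: N_commute\<close>)
  have p5: "\<delta> m0 = \<delta> v0 \<or> \<delta> m2 = \<delta> v0 \<or> \<delta> m0 = \<delta> v3 \<or> \<delta> m2 = \<delta> v3"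
    by (rule ccontr, rule no_P6[of "\<delta> v0" v0 m0 m2 v3 "\<delta> v3"])
      (use d far[THEN far_dom] in \<open>auto simp: N_commute\<close>)
  have p6: "\<delta> m0 = \<delta> v0 \<or> \<delta> m2 = \<delta> v0 \<or> \<delta> m0 = \<delta> v2 \<or> \<delta> m2 = \<delta> v2"
    by (rule ccontr, rule no_P6[of "\<delta> v0" v0 m0 m2 v2 "\<delta> v2"])
      (use d far[THEN far_dom] in \<open>auto simp: N_commute\<close>)
  \<comment> \<open>\<open>v0\<close> and \<open>v5\<close> are consecutive on the cycle if
    \<open>k = 6\<close> and far otherwise, so their relation stays open; \<open>p15\<close> treats
    the adjacent case.\<close>
  have p7: "\<delta> v0 \<noteq> \<delta> v5 \<or> N v0 v5 \<or> \<delta> m0 = \<delta> v5"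
    by (rule ccontr, rule no_P6[of v2 v1 m0 v0 "\<delta> v5" v5])
      (use d far[THEN far_dom] in \<open>auto simp: N_commute\<close>)
  have p8: "\<not> N m2 m4 \<or> \<delta> m2 = \<delta> v4 \<or> \<delta> m4 = \<delta> v4"
    by (rule ccontr, rule no_P6[of "\<delta> v4" v4 m4 m2 v2 v1])
      (use d far[THEN far_dom] in \<open>auto simp: N_commute\<close>)
  have p9: "\<delta> m3 \<noteq> \<delta> v5 \<or> \<not> N m2 m3 \<or> \<delta> m2 = \<delta> v5"
    by (rule ccontr, rule no_P6[of v1 v2 m2 m3 "\<delta> v5" v5])
      (use d far[THEN far_dom] in \<open>auto simp: N_commute\<close>)
  have p10: "\<not> N m3 m4 \<or> \<not> N m2 m3 \<or> N m2 m4"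
    by (rule ccontr, rule no_P6[of v1 v2 m2 m3 m4 v5])
      (use d far[THEN far_dom] in \<open>auto simp: N_commute\<close>)
  have p11: "\<not> N m2 m3 \<or> N m2 m4 \<or> N m3 m4"
    by (rule ccontr, rule no_P6[of v1 v2 m2 m3 v4 m4])
      (use d far[THEN far_dom] in \<open>auto simp: N_commute\<close>)
  have p12: "\<not> N m2 m3 \<or> \<delta> m2 = \<delta> v4 \<or> \<delta> m3 = \<delta> v4"
    by (rule ccontr, rule no_P6[of v1 v2 m2 m3 v4 "\<delta> v4"])
      (use d far[THEN far_dom] in \<open>auto simp: N_commute\<close>)
  have p13: "\<not> N m2 m4 \<or> \<delta> m2 = \<delta> v5 \<or> \<delta> m4 = \<delta> v5"
    by (rule ccontr, rule no_P6[of "\<delta> v5" v5 m4 m2 v2 v1])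
      (use d far[THEN far_dom] in \<open>auto simp: N_commute\<close>)
  have p14: "\<delta> m2 \<noteq> \<delta> v5 \<or> \<delta> v1 = \<delta> v2 \<or> \<delta> m2 = \<delta> v1"
    by (rule ccontr, rule no_P6[of v5 "\<delta> v5" m2 v2 v1 "\<delta> v1"])
      (use d far[THEN far_dom] in \<open>auto simp: N_commute\<close>)
  have p15: "\<not> N m2 m4 \<or> \<not> N v0 v5"
    by (rule ccontr, rule no_P6[of v0 v5 m4 m2 v2 v1])
      (use d far[THEN far_dom] in \<open>auto simp: N_commute\<close>)
  have p16: "\<not> N v3 v4 \<or> \<delta> v3 = \<delta> v4 \<or> \<delta> m2 = \<delta> v4"
    by (rule ccontr, rule no_P6[of v1 v2 m2 v3 v4 "\<delta> v4"])
      (use d far[THEN far_dom] in \<open>auto simp: N_commute\<close>)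
  have p17: "\<delta> v0 \<noteq> \<delta> v1 \<or> \<delta> m2 = \<delta> v0"
    by (rule ccontr, rule no_P6[of v0 "\<delta> v0" v1 v2 m2 v3])
      (use d far[THEN far_dom] in \<open>auto simp: N_commute\<close>)
  have p18: "\<not> N v3 v4 \<or> N m2 m4"
    by (rule ccontr, rule no_P6[of v1 v2 m2 v3 v4 m4])
      (use d far[THEN far_dom] in \<open>auto simp: N_commute\<close>)
  have p19: "N v3 v4 \<or> N m2 m3"
    by (rule ccontr, rule no_P6[of v4 m3 v3 m2 v2 v1])
      (use d far[THEN far_dom] in \<open>auto simp: N_commute\<close>)
  \<comment> \<open>\<open>p10\<close>, \<open>p11\<close>, \<open>p18\<close>, \<open>p19\<close>
    give \<open>N m2 m4\<close>. If \<open>\<delta> m2 = \<delta> v4\<close>, then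
    \<open>p2\<close>, \<open>p4\<close>, \<open>p6\<close>, \<open>p17\<close> clash. Otherwise
    \<open>p8\<close>, \<open>p9\<close>, \<open>p12\<close>, \<open>p13\<close>, \<open>p16\<close>
    lead to \<open>\<delta> m2 = \<delta> v5\<close>, whence
    \<open>\<delta> v1 = \<delta> v2\<close> by \<open>p14\<close>. Now \<open>p3\<close>,
    \<open>p5\<close>, \<open>p6\<close> force \<open>\<delta> v0 = \<delta> v5\<close>, against
    \<open>p3\<close>, \<open>p7\<close>, \<open>p15\<close>.\<close>
  show False
    using p1 p2 p3 p4 p5 p6 p7 p8 p9 p10 p11 p12 p13 p14 p15 p16 p17 p18 p19 d adjacency
    by (smt (verit) N_commute)
qed

lemma consecutive_dom_neq:
  assumes n: "\<not> N v0 v1" "\<not> N v1 v2" "\<not> N v2 v3" "\<not> N v3 v4"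
      "\<not> N v4 v5"
  shows "\<delta> v2 \<noteq> \<delta> v3"
proof
  assume s [simp]: "\<delta> v2 = \<delta> v3"
  have p1: "\<not> N m1 m4 \<or> \<delta> m1 = \<delta> v1 \<or> \<delta> m4 = \<delta> v1 \<or> \<delta> m1 = \<delta> v5 \<or> \<delta> m4 = \<delta> v5"
    by (rule ccontr, rule no_P6[of "\<delta> v1" v1 m1 m4 v5 "\<delta> v5"])
      (use n s far[THEN far_dom] in \<open>auto simp: N_commute\<close>)
  have p2: "\<delta> v3 \<noteq> \<delta> m3 \<or> \<delta> m0 \<noteq> \<delta> v3 \<or> N m0 m3 \<or> \<delta> m0 = \<delta> v4 \<or> \<delta> m3 = \<delta> v4"
    by (rule ccontr, rule no_P6[of "\<delta> v4" v4 m3 "\<delta> v3" m0 v1])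
      (use n s far[THEN far_dom] in \<open>auto simp: N_commute\<close>)
  have p3: "\<not> N m0 m4 \<or> \<delta> m0 = \<delta> v1 \<or> \<delta> m4 = \<delta> v1 \<or> \<delta> m0 = \<delta> v5 \<or> \<delta> m4 = \<delta> v5"
    by (rule ccontr, rule no_P6[of "\<delta> v1" v1 m0 m4 v5 "\<delta> v5"])
      (use n s far[THEN far_dom] in \<open>auto simp: N_commute\<close>)
  have p4: "\<delta> m0 \<noteq> \<delta> m4 \<or> N m0 m4 \<or> \<delta> m4 = \<delta> v1 \<or> \<delta> m0 = \<delta> v4 \<or> \<delta> m4 = \<delta> v4"
    by (rule ccontr, rule no_P6[of "\<delta> v4" v4 m4 "\<delta> m4" m0 v1])
      (use n s far[THEN far_dom] in \<open>auto simp: N_commute\<close>)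
  have p5: "\<not> N m1 m3 \<or> \<delta> m1 = \<delta> v1 \<or> \<delta> m3 = \<delta> v1 \<or> \<delta> m1 = \<delta> v4 \<or> \<delta> m3 = \<delta> v4"
    by (rule ccontr, rule no_P6[of "\<delta> v4" v4 m3 m1 v1 "\<delta> v1"])
      (use n s far[THEN far_dom] in \<open>auto simp: N_commute\<close>)
  have p6: "\<delta> v3 \<noteq> \<delta> m3 \<or> \<delta> m1 \<noteq> \<delta> v3 \<or> N m1 m3 \<or> \<delta> m1 = \<delta> v4 \<or> \<delta> m3 = \<delta> v4"
    by (rule ccontr, rule no_P6[of "\<delta> v4" v4 m3 "\<delta> v3" m1 v1])
      (use n s far[THEN far_dom] in \<open>auto simp: N_commute\<close>)
  have p7: "\<delta> v3 \<noteq> \<delta> m4 \<or> \<delta> m1 \<noteq> \<delta> v3 \<or> N m1 m4 \<or> \<delta> m1 = \<delta> v5 \<or> \<delta> m4 = \<delta> v5"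
    by (rule ccontr, rule no_P6[of "\<delta> v5" v5 m4 "\<delta> v3" m1 v1])
      (use n s far[THEN far_dom] in \<open>auto simp: N_commute\<close>)
  have p8: "\<not> N m0 m3 \<or> \<delta> m0 = \<delta> v1 \<or> \<delta> m3 = \<delta> v1 \<or> \<delta> m0 = \<delta> v4 \<or> \<delta> m3 = \<delta> v4"
    by (rule ccontr, rule no_P6[of "\<delta> v1" v1 m0 m3 v4 "\<delta> v4"])
      (use n s far[THEN far_dom] in \<open>auto simp: N_commute\<close>)
  have p9: "N m3 m4 \<or> \<delta> v3 = \<delta> m3 \<or> \<delta> v3 = \<delta> m4"
    by (rule ccontr, rule no_P6[of m4 v4 m3 v3 "\<delta> v3" v2])
      (use n s far[THEN far_dom] in \<open>auto simp: N_commute\<close>)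
  have p10: "\<not> N m3 m4 \<or> \<delta> m3 = \<delta> v3 \<or> \<delta> m4 = \<delta> v3"
    by (rule ccontr, rule no_P6[of v2 "\<delta> v3" v3 m3 m4 v5])
      (use n s far[THEN far_dom] in \<open>auto simp: N_commute\<close>)
  have p11: "\<not> N m0 m1 \<or> \<delta> m0 = \<delta> v2 \<or> \<delta> m1 = \<delta> v2"
    by (rule ccontr, rule no_P6[of v3 "\<delta> v2" v2 m1 m0 v0])
      (use n s far[THEN far_dom] in \<open>auto simp: N_commute\<close>)
  have p12: "N m0 m1 \<or> \<delta> m0 = \<delta> v2 \<or> \<delta> m1 = \<delta> v2"
    by (rule ccontr, rule no_P6[of m0 v1 m1 v2 "\<delta> v2" v3])
      (use n s far[THEN far_dom] in \<open>auto simp: N_commute\<close>)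
  \<comment> \<open>By \<open>p9\<close> to \<open>p12\<close>, one of \<open>m0\<close>,
    \<open>m1\<close> and one of \<open>m3\<close>, \<open>m4\<close> have the dominator
    \<open>\<delta> v3\<close>. For each of the four choices, a path through that dominator makes
    the two midpoints adjacent (\<open>p2\<close>, \<open>p4\<close>, \<open>p6\<close>,
    \<open>p7\<close>), and a path through the resulting edge refutes this (\<open>p8\<close>,
    \<open>p3\<close>, \<open>p5\<close>, \<open>p1\<close>).\<close>
  show False
    using p1 p2 p3 p4 p5 p6 p7 p8 p9 p10 p11 p12 n s adjacency
    by (smt (verit) N_commute)
qed

lemma distinct_dom_False:
  assumes n: "\<not> N v0 v1" "\<not> N v1 v2" "\<not> N v2 v3" "\<not> N v3 v4"
      "\<not> N v4 v5"
    and s: "\<delta> v0 \<noteq> \<delta> v1" "\<delta> v1 \<noteq> \<delta> v2"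
      "\<delta> v2 \<noteq> \<delta> v3" "\<delta> v3 \<noteq> \<delta> v4"
      "\<delta> v4 \<noteq> \<delta> v5"
  shows False
proof -
  have p1: "\<not> N m3 m4 \<or> \<not> N m1 m3 \<or> N m1 m4 \<or> \<delta> m1 = \<delta> v2 \<or> \<delta> m3 = \<delta> v2 \<or> \<delta> m4 = \<delta> v2"
    by (rule ccontr, rule no_P6[of "\<delta> v2" v2 m1 m3 m4 v5])
      (use n s far[THEN far_dom] in \<open>auto simp: N_commute\<close>)
  have p2: "\<not> N m3 m4 \<or> \<not> N m2 m3 \<or> N m2 m4 \<or> \<delta> m2 = \<delta> v2 \<or> \<delta> m3 = \<delta> v2 \<or> \<delta> m4 = \<delta> v2"
    by (rule ccontr, rule no_P6[of "\<delta> v2" v2 m2 m3 m4 v5])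
      (use n s far[THEN far_dom] in \<open>auto simp: N_commute\<close>)
  have p3: "\<not> N m3 m4 \<or> \<delta> m3 = \<delta> v3 \<or> \<delta> m4 = \<delta> v3 \<or> \<delta> m3 = \<delta> v5 \<or> \<delta> m4 = \<delta> v5"
    by (rule ccontr, rule no_P6[of "\<delta> v3" v3 m3 m4 v5 "\<delta> v5"])
      (use n s far[THEN far_dom] in \<open>auto simp: N_commute\<close>)
  have p4: "\<not> N m2 m3 \<or> \<delta> m2 = \<delta> v2 \<or> \<delta> m3 = \<delta> v2 \<or> \<delta> m2 = \<delta> v4 \<or> \<delta> m3 = \<delta> v4"
    by (rule ccontr, rule no_P6[of "\<delta> v4" v4 m3 m2 v2 "\<delta> v2"])
      (use n s far[THEN far_dom] in \<open>auto simp: N_commute\<close>)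
  have p5: "\<not> N m1 m3 \<or> \<not> N m0 m1 \<or> N m0 m3 \<or> \<delta> m0 = \<delta> v4 \<or> \<delta> m1 = \<delta> v4 \<or> \<delta> m3 = \<delta> v4"
    by (rule ccontr, rule no_P6[of "\<delta> v4" v4 m3 m1 m0 v0])
      (use n s far[THEN far_dom] in \<open>auto simp: N_commute\<close>)
  have p6: "\<not> N m2 m4 \<or> \<delta> m2 = \<delta> v2 \<or> \<delta> m4 = \<delta> v2 \<or> \<delta> m2 = \<delta> v4 \<or> \<delta> m4 = \<delta> v4"
    by (rule ccontr, rule no_P6[of "\<delta> v4" v4 m4 m2 v2 "\<delta> v2"])
      (use n s far[THEN far_dom] in \<open>auto simp: N_commute\<close>)
  have p7: "\<not> N m0 m3 \<or> \<delta> m0 = \<delta> v1 \<or> \<delta> m3 = \<delta> v1 \<or> \<delta> m0 = \<delta> v4 \<or> \<delta> m3 = \<delta> v4"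
    by (rule ccontr, rule no_P6[of "\<delta> v4" v4 m3 m0 v1 "\<delta> v1"])
      (use n s far[THEN far_dom] in \<open>auto simp: N_commute\<close>)
  have p8: "\<not> N m1 m3 \<or> \<delta> m1 = \<delta> v1 \<or> \<delta> m3 = \<delta> v1 \<or> \<delta> m1 = \<delta> v3 \<or> \<delta> m3 = \<delta> v3"
    by (rule ccontr, rule no_P6[of "\<delta> v1" v1 m1 m3 v3 "\<delta> v3"])
      (use n s far[THEN far_dom] in \<open>auto simp: N_commute\<close>)
  have p9: "\<not> N m1 m2 \<or> \<not> N m0 m1 \<or> N m0 m2 \<or> \<delta> m0 = \<delta> v3 \<or> \<delta> m1 = \<delta> v3 \<or> \<delta> m2 = \<delta> v3"
    by (rule ccontr, rule no_P6[of "\<delta> v3" v3 m2 m1 m0 v0])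
      (use n s far[THEN far_dom] in \<open>auto simp: N_commute\<close>)
  have p10: "\<not> N m1 m4 \<or> \<delta> m1 = \<delta> v2 \<or> \<delta> m4 = \<delta> v2 \<or> \<delta> m1 = \<delta> v4 \<or> \<delta> m4 = \<delta> v4"
    by (rule ccontr, rule no_P6[of "\<delta> v4" v4 m4 m1 v2 "\<delta> v2"])
      (use n s far[THEN far_dom] in \<open>auto simp: N_commute\<close>)
  have p11: "\<not> N m1 m2 \<or> \<delta> m1 = \<delta> v1 \<or> \<delta> m2 = \<delta> v1 \<or> \<delta> m1 = \<delta> v3 \<or> \<delta> m2 = \<delta> v3"
    by (rule ccontr, rule no_P6[of "\<delta> v1" v1 m1 m2 v3 "\<delta> v3"])
      (use n s far[THEN far_dom] in \<open>auto simp: N_commute\<close>)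
  have p12: "\<not> N m0 m2 \<or> \<delta> m0 = \<delta> v1 \<or> \<delta> m2 = \<delta> v1 \<or> \<delta> m0 = \<delta> v3 \<or> \<delta> m2 = \<delta> v3"
    by (rule ccontr, rule no_P6[of "\<delta> v1" v1 m0 m2 v3 "\<delta> v3"])
      (use n s far[THEN far_dom] in \<open>auto simp: N_commute\<close>)
  have p13: "\<delta> m1 \<noteq> \<delta> m3 \<or> N m1 m3 \<or> \<delta> m1 = \<delta> v1 \<or> \<delta> m1 = \<delta> v4 \<or> \<delta> m3 = \<delta> v4"
    by (rule ccontr, rule no_P6[of v1 m1 "\<delta> m1" m3 v4 "\<delta> v4"])
      (use n s far[THEN far_dom] in \<open>auto simp: N_commute\<close>)
  have p14: "\<not> N m0 m1 \<or> \<delta> m0 = \<delta> v0 \<or> \<delta> m1 = \<delta> v0 \<or> \<delta> m0 = \<delta> v2 \<or> \<delta> m1 = \<delta> v2"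
    by (rule ccontr, rule no_P6[of "\<delta> v2" v2 m1 m0 v0 "\<delta> v0"])
      (use n s far[THEN far_dom] in \<open>auto simp: N_commute\<close>)
  have p15: "N m0 m1 \<or> \<delta> m0 = \<delta> v2 \<or> \<delta> m1 = \<delta> v2"
    by (rule ccontr, rule no_P6[of v0 m0 v1 m1 v2 "\<delta> v2"])
      (use n s far[THEN far_dom] in \<open>auto simp: N_commute\<close>)
  have p16: "\<delta> m1 \<noteq> \<delta> v3 \<or> N m1 m3 \<or> \<delta> m3 = \<delta> v3"
    by (rule ccontr, rule no_P6[of v4 m3 v3 "\<delta> v3" m1 v2])
      (use n s far[THEN far_dom] in \<open>auto simp: N_commute\<close>)
  have p17: "N m1 m2 \<or> \<delta> m1 = \<delta> v3 \<or> \<delta> m2 = \<delta> v3"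
    by (rule ccontr, rule no_P6[of "\<delta> v3" v3 m2 v2 m1 v1])
      (use n s far[THEN far_dom] in \<open>auto simp: N_commute\<close>)
  have p18: "\<delta> m3 \<noteq> \<delta> v2 \<or> N m1 m3 \<or> \<delta> m1 = \<delta> v2"
    by (rule ccontr, rule no_P6[of v3 m3 "\<delta> v2" v2 m1 v1])
      (use n s far[THEN far_dom] in \<open>auto simp: N_commute\<close>)
  have p19: "N m0 m1 \<or> \<delta> m0 = \<delta> v0 \<or> \<delta> m1 = \<delta> v0"
    by (rule ccontr, rule no_P6[of "\<delta> v0" v0 m0 v1 m1 v2])
      (use n s far[THEN far_dom] in \<open>auto simp: N_commute\<close>)
  have p20: "N m2 m3 \<or> \<delta> m2 = \<delta> v2 \<or> \<delta> m3 = \<delta> v2"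
    by (rule ccontr, rule no_P6[of v4 m3 v3 m2 v2 "\<delta> v2"])
      (use n s far[THEN far_dom] in \<open>auto simp: N_commute\<close>)
  have p21: "N m3 m4 \<or> \<delta> m3 = \<delta> v5 \<or> \<delta> m4 = \<delta> v5"
    by (rule ccontr, rule no_P6[of v3 m3 v4 m4 v5 "\<delta> v5"])
      (use n s far[THEN far_dom] in \<open>auto simp: N_commute\<close>)
  have p22: "N m3 m4 \<or> \<delta> m3 = \<delta> v3 \<or> \<delta> m4 = \<delta> v3"
    by (rule ccontr, rule no_P6[of v5 m4 v4 m3 v3 "\<delta> v3"])
      (use n s far[THEN far_dom] in \<open>auto simp: N_commute\<close>)
  \<comment> \<open>Of two consecutive midpoints \<open>m i\<close>, \<open>m (i + 1)\<close>, one
    has the dominator of \<open>v i\<close> or \<open>v (i + 2)\<close>: by \<open>p14\<close>,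
    \<open>p11\<close>, \<open>p4\<close>, \<open>p3\<close> if they are adjacent, and by
    \<open>p15\<close> and \<open>p19\<close>, \<open>p17\<close>, \<open>p20\<close>,
    \<open>p21\<close> and \<open>p22\<close> if not. The other disjunctions, mostly about
    nonconsecutive midpoints, refute every combination of these choices.\<close>
  show False
    using p1 p2 p3 p4 p5 p6 p7 p8 p9 p10 p11 p12 p13 p14 p15 p16 p17 p18 p19 p20 p21 p22 n s
      adjacency
    by (smt (verit) N_commute)
qed

end

section \<open>Five-cycles of the square\<close>

text \<open>On five vertices \<open>v0\<close> and \<open>v4\<close> are consecutive, so
  \<open>far v0 v4\<close> from \<open>square_path\<close> fails; instead the fifth midpoint leads
  back to \<open>v0\<close>.\<close>

locale square_five_cycle = P6_free_dominated +
  fixes v0 v1 v2 v3 v4 m0 m1 m2 m3 m4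
  assumes far: "far v0 v2" "far v0 v3" "far v1 v3" "far v1 v4" "far v2 v4"
    and link: "N v0 m0" "N m0 v1" "N v1 m1" "N m1 v2" "N v2 m2" "N m2 v3" "N v3 m3" "N m3 v4"
      "N v4 m4" "N m4 v0"
begin

lemma not_adj_mid:
  shows "\<not> N v2 m0" "\<not> N v3 m0" "\<not> N v4 m0" "\<not> N v0 m1" "\<not> N v3 m1"
      "\<not> N v4 m1" "\<not> N v0 m2" "\<not> N v1 m2" "\<not> N v4 m2" "\<not> N v0 m3"
      "\<not> N v1 m3" "\<not> N v2 m3" "\<not> N v1 m4" "\<not> N v2 m4" "\<not> N v3 m4"
  using far link far_mid N_sym far_commute by metis+

lemmas adjacency [simp] =
  far[THEN far_not_adj] far[THEN far_commute[THEN iffD1], THEN far_not_adj]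
  far[THEN far_dom] far[THEN far_dom, symmetric]
  link link[THEN N_sym] not_adj_mid not_adj_mid[THEN not_N_sym]

lemma consecutive_not_adj: "\<not> N v0 v1"
proof
  assume d: "N v0 v1"
  \<comment> \<open>Two successive edges would give far vertices a common neighbour;
    \<open>e\<close> holds for the same reason at \<open>v3\<close>.\<close>
  have n [simp]: "\<not> N v1 v2" "\<not> N v2 v1" "\<not> N v4 v0" "\<not> N v0 v4"
    using d far link far_mid N_commute by metis+
  have e: "\<not> N v2 v3 \<or> \<not> N v3 v4"
    using far far_mid N_commute by metis
  have p1 [simp]: "N m1 m4"
    by (rule ccontr, rule no_P6[of v2 m1 v1 v0 m4 v4])
      (use d far[THEN far_dom] in \<open>auto simp: N_commute\<close>)
  have p2: "\<delta> m1 = \<delta> v0 \<or> \<delta> m4 = \<delta> v0 \<or> \<delta> m1 = \<delta> v2 \<or> \<delta> m4 = \<delta> v2"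
    by (rule ccontr, rule no_P6[of "\<delta> v2" v2 m1 m4 v0 "\<delta> v0"])
      (use d far[THEN far_dom] in \<open>auto simp: N_commute\<close>)
  have p3: "\<not> N m2 m4 \<or> \<delta> m2 = \<delta> v0 \<or> \<delta> m4 = \<delta> v0 \<or> \<delta> m2 = \<delta> v2 \<or> \<delta> m4 = \<delta> v2"
    by (rule ccontr, rule no_P6[of "\<delta> v2" v2 m2 m4 v0 "\<delta> v0"])
      (use d far[THEN far_dom] in \<open>auto simp: N_commute\<close>)
  have p4: "\<not> N m2 m3 \<or> \<delta> m2 = \<delta> v2 \<or> \<delta> m3 = \<delta> v2 \<or> \<delta> m2 = \<delta> v4 \<or> \<delta> m3 = \<delta> v4"
    by (rule ccontr, rule no_P6[of "\<delta> v4" v4 m3 m2 v2 "\<delta> v2"])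
      (use d far[THEN far_dom] in \<open>auto simp: N_commute\<close>)
  have p5: "\<delta> m2 \<noteq> \<delta> m3 \<or> N m2 m3 \<or> \<delta> m2 = \<delta> v2 \<or> \<delta> m3 = \<delta> v2 \<or> \<delta> m2 = \<delta> v4"
    by (rule ccontr, rule no_P6[of "\<delta> v2" v2 m2 "\<delta> m2" m3 v4])
      (use d far[THEN far_dom] in \<open>auto simp: N_commute\<close>)
  have p6: "\<delta> m1 = \<delta> v1 \<or> \<delta> m4 = \<delta> v1 \<or> \<delta> m1 = \<delta> v4 \<or> \<delta> m4 = \<delta> v4"
    by (rule ccontr, rule no_P6[of "\<delta> v1" v1 m1 m4 v4 "\<delta> v4"])
      (use d far[THEN far_dom] in \<open>auto simp: N_commute\<close>)
  have p7: "\<not> N m1 m2 \<or> \<delta> m1 = \<delta> v3 \<or> \<delta> m2 = \<delta> v3"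
    by (rule ccontr, rule no_P6[of v0 v1 m1 m2 v3 "\<delta> v3"])
      (use d far[THEN far_dom] in \<open>auto simp: N_commute\<close>)
  have p8: "\<delta> m3 \<noteq> \<delta> v2 \<or> \<not> N m3 m4 \<or> \<delta> v1 = \<delta> v2 \<or> \<delta> m4 = \<delta> v2"
    by (rule ccontr, rule no_P6[of v1 v0 m4 m3 "\<delta> v2" v2])
      (use d far[THEN far_dom] in \<open>auto simp: N_commute\<close>)
  have p9: "\<not> N m3 m4 \<or> \<not> N m2 m3 \<or> N m2 m4"
    by (rule ccontr, rule no_P6[of v1 v0 m4 m3 m2 v2])
      (use d far[THEN far_dom] in \<open>auto simp: N_commute\<close>)
  have p10: "\<not> N m3 m4 \<or> \<not> N v2 v3"
    by (rule ccontr, rule no_P6[of v2 v3 m3 m4 v0 v1])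
      (use d far[THEN far_dom] in \<open>auto simp: N_commute\<close>)
  have p11: "\<not> N m2 m4 \<or> \<delta> m2 = \<delta> v3 \<or> \<delta> m4 = \<delta> v3"
    by (rule ccontr, rule no_P6[of "\<delta> v3" v3 m2 m4 v0 v1])
      (use d far[THEN far_dom] in \<open>auto simp: N_commute\<close>)
  have p12: "\<delta> v3 \<noteq> \<delta> v4 \<or> N v3 v4 \<or> \<delta> m4 = \<delta> v3"
    by (rule ccontr, rule no_P6[of v3 "\<delta> v3" v4 m4 v0 v1])
      (use d far[THEN far_dom] in \<open>auto simp: N_commute\<close>)
  have p13: "\<not> N m3 m4 \<or> N m2 m3 \<or> N m2 m4"
    by (rule ccontr, rule no_P6[of v1 v0 m4 m3 v3 m2])
      (use d far[THEN far_dom] in \<open>auto simp: N_commute\<close>)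
  have p14: "N v3 v4 \<or> N m3 m4"
    by (rule ccontr, rule no_P6[of v3 m3 v4 m4 v0 v1])
      (use d far[THEN far_dom] in \<open>auto simp: N_commute\<close>)
  have p15: "\<delta> v2 \<noteq> \<delta> v3 \<or> N v2 v3 \<or> \<delta> m1 = \<delta> v3"
    by (rule ccontr, rule no_P6[of v3 "\<delta> v3" v2 m1 v1 v0])
      (use d far[THEN far_dom] in \<open>auto simp: N_commute\<close>)
  have p16: "\<not> N m3 m4 \<or> \<delta> m3 = \<delta> v3 \<or> \<delta> m4 = \<delta> v3"
    by (rule ccontr, rule no_P6[of "\<delta> v3" v3 m3 m4 v0 v1])
      (use d far[THEN far_dom] in \<open>auto simp: N_commute\<close>)
  have p17: "\<not> N m1 m2 \<or> \<not> N v3 v4"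
    by (rule ccontr, rule no_P6[of v4 v3 m2 m1 v1 v0])
      (use d far[THEN far_dom] in \<open>auto simp: N_commute\<close>)
  have p18: "N v2 v3 \<or> N m1 m2"
    by (rule ccontr, rule no_P6[of v0 v1 m1 v2 m2 v3])
      (use d far[THEN far_dom] in \<open>auto simp: N_commute\<close>)
  \<comment> \<open>\<open>e\<close>, \<open>p10\<close>, \<open>p14\<close>, \<open>p17\<close>,
    \<open>p18\<close> leave \<open>v3\<close> adjacent to neither \<open>v2\<close> nor
    \<open>v4\<close>, with \<open>N m1 m2\<close> and \<open>N m3 m4\<close>; \<open>p9\<close> and
    \<open>p13\<close> add \<open>N m2 m4\<close>. If \<open>\<delta> m4 = \<delta> v3\<close>, then
    \<open>p2\<close>, \<open>p3\<close>, \<open>p6\<close>, \<open>p7\<close>, \<open>p15\<close>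
    clash. Otherwise \<open>p11\<close>, \<open>p16\<close> give \<open>m2\<close> and
    \<open>m3\<close> the dominator \<open>\<delta> v3\<close>, then \<open>p4\<close>,
    \<open>p5\<close>, \<open>p12\<close> force \<open>\<delta> v2 = \<delta> v3\<close>, and
    \<open>p8\<close> fails.\<close>
  show False
    using p1 p2 p3 p4 p5 p6 p7 p8 p9 p10 p11 p12 p13 p14 p15 p16 p17 p18 e d adjacency
    by (smt (verit) N_commute)
qed

lemma consecutive_dom_neq:
  assumes n: "\<not> N v0 v1" "\<not> N v1 v2" "\<not> N v2 v3" "\<not> N v3 v4"
      "\<not> N v4 v0"
  shows "\<delta> v2 \<noteq> \<delta> v3"
proof
  assume s [simp]: "\<delta> v2 = \<delta> v3"
  have p1: "\<not> N m0 m4 \<or> \<delta> m0 = \<delta> v1 \<or> \<delta> m4 = \<delta> v1 \<or> \<delta> m0 = \<delta> v4 \<or> \<delta> m4 = \<delta> v4"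
    by (rule ccontr, rule no_P6[of "\<delta> v1" v1 m0 m4 v4 "\<delta> v4"])
      (use n s far[THEN far_dom] in \<open>auto simp: N_commute\<close>)
  have p2: "\<delta> m1 \<noteq> \<delta> v3 \<or> \<not> N m0 m1 \<or> \<delta> m0 = \<delta> v0 \<or> \<delta> m1 = \<delta> v0 \<or> \<delta> m0 = \<delta> v3"
    by (rule ccontr, rule no_P6[of v3 "\<delta> v3" m1 m0 v0 "\<delta> v0"])
      (use n s far[THEN far_dom] in \<open>auto simp: N_commute\<close>)
  have p3: "\<delta> m3 \<noteq> \<delta> v2 \<or> \<not> N m3 m4 \<or> \<delta> m3 = \<delta> v0 \<or> \<delta> m4 = \<delta> v0 \<or> \<delta> m4 = \<delta> v2"
    by (rule ccontr, rule no_P6[of v2 "\<delta> v2" m3 m4 v0 "\<delta> v0"])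
      (use n s far[THEN far_dom] in \<open>auto simp: N_commute\<close>)
  have p4: "N m0 m1 \<or> \<delta> v0 = \<delta> v1 \<or> \<delta> m0 = \<delta> v0 \<or> \<delta> m1 = \<delta> v0"
    by (rule ccontr, rule no_P6[of "\<delta> v0" v0 m0 v1 m1 v2])
      (use n s far[THEN far_dom] in \<open>auto simp: N_commute\<close>)
  have p5: "N m3 m4 \<or> \<delta> v0 = \<delta> v4 \<or> \<delta> m3 = \<delta> v0 \<or> \<delta> m4 = \<delta> v0"
    by (rule ccontr, rule no_P6[of v3 m3 v4 m4 v0 "\<delta> v0"])
      (use n s far[THEN far_dom] in \<open>auto simp: N_commute\<close>)
  have p6: "N m0 m4 \<or> \<delta> v0 = \<delta> v4 \<or> \<delta> m0 = \<delta> v4 \<or> \<delta> m4 = \<delta> v4"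
    by (rule ccontr, rule no_P6[of v1 m0 v0 m4 v4 "\<delta> v4"])
      (use n s far[THEN far_dom] in \<open>auto simp: N_commute\<close>)
  have p7: "\<not> N m3 m4 \<or> \<delta> v3 = \<delta> m3 \<or> \<delta> v3 = \<delta> m4"
    by (rule ccontr, rule no_P6[of v2 "\<delta> v3" v3 m3 m4 v0])
      (use n s far[THEN far_dom] in \<open>auto simp: N_commute\<close>)
  have p8: "\<not> N m0 m1 \<or> \<delta> m0 = \<delta> v3 \<or> \<delta> m1 = \<delta> v3"
    by (rule ccontr, rule no_P6[of v0 m0 m1 v2 "\<delta> v3" v3])
      (use n s far[THEN far_dom] in \<open>auto simp: N_commute\<close>)
  have p9: "\<delta> m3 \<noteq> \<delta> v3 \<or> \<delta> v0 \<noteq> \<delta> v4 \<or> \<delta> m3 = \<delta> v0"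
    by (rule ccontr, rule no_P6[of v0 "\<delta> v0" v4 m3 "\<delta> v3" v2])
      (use n s far[THEN far_dom] in \<open>auto simp: N_commute\<close>)
  have p10: "\<delta> v0 \<noteq> \<delta> v1 \<or> \<delta> m1 \<noteq> \<delta> v3 \<or> \<delta> m1 = \<delta> v1"
    by (rule ccontr, rule no_P6[of v0 "\<delta> v1" v1 m1 "\<delta> v3" v3])
      (use n s far[THEN far_dom] in \<open>auto simp: N_commute\<close>)
  have p11: "\<delta> m1 = \<delta> v3 \<or> \<delta> m1 = \<delta> v1"
    by (rule ccontr, rule no_P6[of "\<delta> v1" v1 m1 v2 "\<delta> v3" v3])
      (use n s far[THEN far_dom] in \<open>auto simp: N_commute\<close>)
  have p12: "\<delta> m1 \<noteq> \<delta> v0 \<or> \<delta> m1 = \<delta> v3"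
    by (rule ccontr, rule no_P6[of v3 "\<delta> v3" v2 m1 "\<delta> v0" v0])
      (use n s far[THEN far_dom] in \<open>auto simp: N_commute\<close>)
  have p13: "\<delta> m3 = \<delta> v2 \<or> \<delta> m3 = \<delta> v4"
    by (rule ccontr, rule no_P6[of "\<delta> v4" v4 m3 v3 "\<delta> v2" v2])
      (use n s far[THEN far_dom] in \<open>auto simp: N_commute\<close>)
  have p14: "\<delta> m3 \<noteq> \<delta> v0 \<or> \<delta> m3 = \<delta> v3"
    by (rule ccontr, rule no_P6[of v2 "\<delta> v3" v3 m3 "\<delta> v0" v0])
      (use n s far[THEN far_dom] in \<open>auto simp: N_commute\<close>)
  \<comment> \<open>\<open>p9\<close> to \<open>p14\<close> separate \<open>\<delta> v0\<close> from
    \<open>\<delta> v1\<close> and \<open>\<delta> v4\<close>. Then \<open>m0\<close> (by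
    \<open>p2\<close>, \<open>p4\<close>, \<open>p8\<close>) and \<open>m4\<close> (by
    \<open>p3\<close>, \<open>p5\<close>, \<open>p7\<close>) have dominator
    \<open>\<delta> v0\<close> or \<open>\<delta> v2\<close>, so \<open>p1\<close> forbids and
    \<open>p6\<close> demands \<open>N m0 m4\<close>.\<close>
  show False
    using p1 p2 p3 p4 p5 p6 p7 p8 p9 p10 p11 p12 p13 p14 n s adjacency
    by (smt (verit) N_commute)
qed

lemma distinct_dom_False:
  assumes n: "\<not> N v0 v1" "\<not> N v1 v2" "\<not> N v2 v3" "\<not> N v3 v4"
      "\<not> N v4 v0"
    and s: "\<delta> v0 \<noteq> \<delta> v1" "\<delta> v1 \<noteq> \<delta> v2"
      "\<delta> v2 \<noteq> \<delta> v3" "\<delta> v3 \<noteq> \<delta> v4"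
      "\<delta> v4 \<noteq> \<delta> v0"
  shows False
proof -
  have p1: "\<not> N m0 m1 \<or> \<delta> m0 = \<delta> v0 \<or> \<delta> m1 = \<delta> v0 \<or> \<delta> m0 = \<delta> v2 \<or> \<delta> m1 = \<delta> v2"
    by (rule ccontr, rule no_P6[of "\<delta> v2" v2 m1 m0 v0 "\<delta> v0"])
      (use n s far[THEN far_dom] in \<open>auto simp: N_commute\<close>)
  have p2: "\<not> N m2 m4 \<or> \<delta> m2 = \<delta> v0 \<or> \<delta> m4 = \<delta> v0 \<or> \<delta> m2 = \<delta> v2 \<or> \<delta> m4 = \<delta> v2"
    by (rule ccontr, rule no_P6[of "\<delta> v0" v0 m4 m2 v2 "\<delta> v2"])
      (use n s far[THEN far_dom] in \<open>auto simp: N_commute\<close>)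
  have p3: "\<not> N m3 m4 \<or> \<not> N m2 m3 \<or> N m2 m4 \<or> \<delta> m2 = \<delta> v0 \<or> \<delta> m3 = \<delta> v0 \<or> \<delta> m4 = \<delta> v0"
    by (rule ccontr, rule no_P6[of "\<delta> v0" v0 m4 m3 m2 v2])
      (use n s far[THEN far_dom] in \<open>auto simp: N_commute\<close>)
  have p4: "\<not> N m2 m3 \<or> \<delta> m2 = \<delta> v2 \<or> \<delta> m3 = \<delta> v2 \<or> \<delta> m2 = \<delta> v4 \<or> \<delta> m3 = \<delta> v4"
    by (rule ccontr, rule no_P6[of "\<delta> v4" v4 m3 m2 v2 "\<delta> v2"])
      (use n s far[THEN far_dom] in \<open>auto simp: N_commute\<close>)
  have p5: "\<not> N m0 m3 \<or> \<delta> m0 = \<delta> v1 \<or> \<delta> m3 = \<delta> v1 \<or> \<delta> m0 = \<delta> v3 \<or> \<delta> m3 = \<delta> v3"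
    by (rule ccontr, rule no_P6[of "\<delta> v1" v1 m0 m3 v3 "\<delta> v3"])
      (use n s far[THEN far_dom] in \<open>auto simp: N_commute\<close>)
  have p6: "\<not> N m3 m4 \<or> \<not> N m0 m4 \<or> N m0 m3 \<or> \<delta> m0 = \<delta> v3 \<or> \<delta> m3 = \<delta> v3 \<or> \<delta> m4 = \<delta> v3"
    by (rule ccontr, rule no_P6[of "\<delta> v3" v3 m3 m4 m0 v1])
      (use n s far[THEN far_dom] in \<open>auto simp: N_commute\<close>)
  have p7: "\<not> N m1 m2 \<or> \<delta> m1 = \<delta> v1 \<or> \<delta> m2 = \<delta> v1 \<or> \<delta> m1 = \<delta> v3 \<or> \<delta> m2 = \<delta> v3"
    by (rule ccontr, rule no_P6[of "\<delta> v1" v1 m1 m2 v3 "\<delta> v3"])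
      (use n s far[THEN far_dom] in \<open>auto simp: N_commute\<close>)
  have p8: "\<not> N m0 m3 \<or> \<delta> m0 = \<delta> v0 \<or> \<delta> m3 = \<delta> v0 \<or> \<delta> m0 = \<delta> v3 \<or> \<delta> m3 = \<delta> v3"
    by (rule ccontr, rule no_P6[of "\<delta> v3" v3 m3 m0 v0 "\<delta> v0"])
      (use n s far[THEN far_dom] in \<open>auto simp: N_commute\<close>)
  have p9: "\<not> N m0 m4 \<or> \<delta> m0 = \<delta> v1 \<or> \<delta> m4 = \<delta> v1 \<or> \<delta> m0 = \<delta> v4 \<or> \<delta> m4 = \<delta> v4"
    by (rule ccontr, rule no_P6[of "\<delta> v4" v4 m4 m0 v1 "\<delta> v1"])
      (use n s far[THEN far_dom] in \<open>auto simp: N_commute\<close>)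
  have p10: "\<not> N m2 m4 \<or> \<delta> m2 = \<delta> v0 \<or> \<delta> m4 = \<delta> v0 \<or> \<delta> m2 = \<delta> v3 \<or> \<delta> m4 = \<delta> v3"
    by (rule ccontr, rule no_P6[of "\<delta> v3" v3 m2 m4 v0 "\<delta> v0"])
      (use n s far[THEN far_dom] in \<open>auto simp: N_commute\<close>)
  have p11: "N m2 m3 \<or> \<delta> m2 = \<delta> v4 \<or> \<delta> m3 = \<delta> v4"
    by (rule ccontr, rule no_P6[of v2 m2 v3 m3 v4 "\<delta> v4"])
      (use n s far[THEN far_dom] in \<open>auto simp: N_commute\<close>)
  have p12: "N m3 m4 \<or> \<delta> m3 = \<delta> v0 \<or> \<delta> m4 = \<delta> v0"
    by (rule ccontr, rule no_P6[of "\<delta> v0" v0 m4 v4 m3 v3])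
      (use n s far[THEN far_dom] in \<open>auto simp: N_commute\<close>)
  have p13: "N m3 m4 \<or> \<delta> m3 = \<delta> v3 \<or> \<delta> m4 = \<delta> v3"
    by (rule ccontr, rule no_P6[of "\<delta> v3" v3 m3 v4 m4 v0])
      (use n s far[THEN far_dom] in \<open>auto simp: N_commute\<close>)
  have p14: "N m2 m3 \<or> \<delta> m2 = \<delta> v2 \<or> \<delta> m3 = \<delta> v2"
    by (rule ccontr, rule no_P6[of v4 m3 v3 m2 v2 "\<delta> v2"])
      (use n s far[THEN far_dom] in \<open>auto simp: N_commute\<close>)
  have p15: "N m0 m4 \<or> \<delta> m0 = \<delta> v1 \<or> \<delta> m4 = \<delta> v1"
    by (rule ccontr, rule no_P6[of "\<delta> v1" v1 m0 v0 m4 v4])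
      (use n s far[THEN far_dom] in \<open>auto simp: N_commute\<close>)
  have p16: "N m1 m2 \<or> \<delta> m1 = \<delta> v3 \<or> \<delta> m2 = \<delta> v3"
    by (rule ccontr, rule no_P6[of "\<delta> v3" v3 m2 v2 m1 v1])
      (use n s far[THEN far_dom] in \<open>auto simp: N_commute\<close>)
  have p17: "N m0 m1 \<or> \<delta> m0 = \<delta> v2 \<or> \<delta> m1 = \<delta> v2"
    by (rule ccontr, rule no_P6[of v0 m0 v1 m1 v2 "\<delta> v2"])
      (use n s far[THEN far_dom] in \<open>auto simp: N_commute\<close>)
  have p18: "N m0 m4 \<or> \<delta> m0 = \<delta> v4 \<or> \<delta> m4 = \<delta> v4"
    by (rule ccontr, rule no_P6[of v1 m0 v0 m4 v4 "\<delta> v4"])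
      (use n s far[THEN far_dom] in \<open>auto simp: N_commute\<close>)
  \<comment> \<open>By \<open>p1\<close> and \<open>p17\<close>, \<open>m0\<close> or
    \<open>m1\<close> has the dominator of \<open>v0\<close> or \<open>v2\<close>. As all five
    dominators differ, the choice propagates around the cycle: for \<open>m0\<close> it ends in a
    conflict with \<open>p10\<close>, otherwise in one with \<open>p8\<close>.\<close>
  show False
    using p1 p2 p3 p4 p5 p6 p7 p8 p9 p10 p11 p12 p13 p14 p15 p16 p17 p18 n s adjacency
    by (smt (verit) N_commute)
qed

end

section \<open>Sliding windows along a periodic sequence\<close>

context P6_free_dominated
begin

text \<open>The two locales treat one fixed consecutive pair of a window. Sliding the window along
  the unrolled cycle carries nonadjacency, and then distinct dominators, to all the pairs that
  \<open>distinct_dom_False\<close> asks for.\<close>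

lemma no_square_cycle:
  fixes w :: "nat \<Rightarrow> 'a"
  assumes k: "5 \<le> k" and periodic: "\<And>i. w (i + k) = w i"
    and near: "\<And>i. \<exists>z. N (w i) z \<and> N z (w (i + 1))"
    and far: "\<And>i d. 2 \<le> d \<Longrightarrow> d + 2 \<le> k \<Longrightarrow> far (w i) (w (i + d))"
  shows False
proof -
  \<comment> \<open>A midpoint may coincide with one of its ends, as \<open>N\<close> is
    reflexive.\<close>
  obtain m where m: "\<And>i. N (w i) (m i)" "\<And>i. N (m i) (w (i + 1))"
    using near by metis
  have far': "far (w a) (w b)" if "a + 2 \<le> b" "b + 2 \<le> a + k" for a b
    using far[of "b - a" a] that by simp
  \<comment> \<open>The second alternative is the wrap-around link from the last midpoint to the
    first vertex, used for \<open>k = 5\<close>.\<close>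
  have mid: "N (m a) (w b)" if "b = a + 1 \<or> b + k = a + 1" for a b
    using m(2)[of a] periodic[of b] that by auto
  show False
  proof (cases "k = 5")
    case True
    have cycle: "square_five_cycle N \<delta> (w i) (w (i + 1)) (w (i + 2)) (w (i + 3)) (w (i + 4))
        (m i) (m (i + 1)) (m (i + 2)) (m (i + 3)) (m (i + 4))" for i
      by unfold_locales (simp_all add: far' mid m(1) True)
    have n: "\<not> N (w i) (w (i + 1))" for i
      using square_five_cycle.consecutive_not_adj[OF cycle[of i]] .
    have w5: "w (i + 5) = w i" for i
      using periodic[of i] True by simp
    have n': "\<not> N (w i) (w (i + 1))" "\<not> N (w (i + 1)) (w (i + 2))" "\<not> N (w (i + 2)) (w (i + 3))"
      "\<not> N (w (i + 3)) (w (i + 4))" "\<not> N (w (i + 4)) (w i)" for i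
      using n[of i] n[of "i + 1"] n[of "i + 2"] n[of "i + 3"] n[of "i + 4"] w5[of i]
      by (simp_all add: numeral_eq_Suc)
    have s: "\<delta> (w (i + 2)) \<noteq> \<delta> (w (i + 3))" for i
      using square_five_cycle.consecutive_dom_neq[OF cycle[of i] n'[of i]] .
    \<comment> \<open>The last pair comes from \<open>w 7\<close> and \<open>w 8\<close>, where
      \<open>w 8 = w 3\<close>.\<close>
    have s': "\<delta> (w 3) \<noteq> \<delta> (w 4)" "\<delta> (w 4) \<noteq> \<delta> (w 5)" "\<delta> (w 5) \<noteq> \<delta> (w 6)" "\<delta> (w 6) \<noteq> \<delta> (w 7)"
      "\<delta> (w 7) \<noteq> \<delta> (w 3)"
      using s[of 1] s[of 2] s[of 3] s[of 4] s[of 5] w5[of 3] by (simp_all add: numeral_eq_Suc)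
    show False
      using square_five_cycle.distinct_dom_False[OF cycle[of 3] n'[of 3]] s' by simp
  next
    case False
    with k have k6: "6 \<le> k" by simp
    \<comment> \<open>Index difference 4 is far exactly because \<open>6 \<le> k\<close>; difference
      5 would require \<open>7 \<le> k\<close>, and \<open>square_path\<close> leaves that pair
      open.\<close>
    have path: "square_path N \<delta> (w i) (w (i + 1)) (w (i + 2)) (w (i + 3)) (w (i + 4)) (w (i + 5))
        (m i) (m (i + 1)) (m (i + 2)) (m (i + 3)) (m (i + 4))" for i
      by unfold_locales (use k6 in \<open>simp_all add: far' mid m(1)\<close>)
    have n: "\<not> N (w (i + 1)) (w (i + 2))" for i
      using square_path.consecutive_not_adj[OF path[of i]] .
    \<comment> \<open>\<open>n\<close> concerns the second and third vertex of a window, hence the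
      window at \<open>i - 1\<close> and the bound \<open>1 \<le> i\<close>. \<open>s\<close> shifts
      by two more, so the final window starts at 3.\<close>
    have n': "\<not> N (w i) (w (i + 1))" "\<not> N (w (i + 1)) (w (i + 2))" "\<not> N (w (i + 2)) (w (i + 3))"
      "\<not> N (w (i + 3)) (w (i + 4))" "\<not> N (w (i + 4)) (w (i + 5))" if "1 \<le> i" for i
      using n[of "i - 1"] n[of i] n[of "i + 1"] n[of "i + 2"] n[of "i + 3"] that
      by (simp_all add: numeral_eq_Suc)
    have s: "\<delta> (w (i + 2)) \<noteq> \<delta> (w (i + 3))" if "1 \<le> i" for i
      using square_path.consecutive_dom_neq[OF path[of i] n'[OF that]] .
    show False
      using square_path.distinct_dom_False[OF path[of 3] n'[of 3]] s[of 1] s[of 2] s[of 3] s[of 4] s[of 5]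
      by (simp add: numeral_eq_Suc)
  qed
qed

end

section \<open>Transfer to graphs and the squares of \<open>P_6\<close>-free graphs\<close>

text \<open>Inside the graph \<open>N_dom\<close> is uniqueness of the dominator. Outside, no arcs
  exist and \<open>\<delta>\<close> is the identity, so both sides reduce to equality.\<close>

lemma P6_free_dominatedI:
  assumes "pair_graph G" and "induced_free (path_graph 6) G" and D: "efficient_dominating_set G D"
    and dom: "\<And>u. u \<in> pverts G \<Longrightarrow> \<delta> u \<in> D \<and> dominates G (\<delta> u) u"
    and outside: "\<And>u. u \<notin> pverts G \<Longrightarrow> \<delta> u = u"
  shows "P6_free_dominated (dominates G) \<delta>"
proof
  interpret pair_graph G by fact
  have sym: "(y, x) \<in> parcs G" if "(x, y) \<in> parcs G" for x y
    using that pair_sym_arcs by (auto simp: symmetric_def dest: symD)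
  show refl: "dominates G x x" for x
    by (simp add: dominates_def)
  show commute: "dominates G y x" if "dominates G x y" for x y
    using that sym by (auto simp: dominates_def)
  have unique: "d = \<delta> u" if "u \<in> pverts G" "d \<in> D" "dominates G d u" for u d
    using D dom[OF that(1)] that by (auto simp: efficient_dominating_set_def)
  have D_verts: "D \<subseteq> pverts G"
    using D by (simp add: efficient_dominating_set_def)
  have \<delta>_verts: "\<delta> u \<in> pverts G \<longleftrightarrow> u \<in> pverts G" for u
    using dom[of u] outside[of u] D_verts by (cases "u \<in> pverts G") auto
  have verts: "x \<in> pverts G \<longleftrightarrow> y \<in> pverts G" if "dominates G x y" for x y
    using that in_arcsD1 in_arcsD2 by (auto simp: dominates_def)
  show "dominates G (\<delta> u) w \<longleftrightarrow> \<delta> u = \<delta> w" for u w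
  proof (cases "u \<in> pverts G \<and> w \<in> pverts G")
    case True
    then show ?thesis
      using dom[of u] dom[of w] unique[of w "\<delta> u"] by auto
  next
    case False
    then have "dominates G (\<delta> u) w \<longleftrightarrow> \<delta> u = w"
      using \<delta>_verts[of u] verts[of "\<delta> u" w] in_arcsD1 in_arcsD2 by (auto simp: dominates_def)
    then show ?thesis
      using False \<delta>_verts[of u] \<delta>_verts[of w] outside[of u] outside[of w] by metis
  qed
  show False if path: "dominates G a b" "dominates G b c" "dominates G c d" "dominates G d e"
      "dominates G e f" "\<not> dominates G a c" "\<not> dominates G a d" "\<not> dominates G a e"
      "\<not> dominates G a f" "\<not> dominates G b d" "\<not> dominates G b e" "\<not> dominates G b f"
      "\<not> dominates G c e" "\<not> dominates G c f" "\<not> dominates G d f" for a b c d e f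
  proof -
    let ?p = "\<lambda>i. [a, b, c, d, e, f] ! i"
    \<comment> \<open>If two consecutive entries coincided, one of them would be related to a vertex
      two places away. Nonconsecutive entries differ since \<open>N\<close> is reflexive.\<close>
    have neq: "distinct [a, b, c, d, e, f]"
      using path refl commute by auto
    then have arcs: "(a, b) \<in> parcs G" "(b, c) \<in> parcs G" "(c, d) \<in> parcs G" "(d, e) \<in> parcs G"
      "(e, f) \<in> parcs G"
      using path by (auto simp: dominates_def)
    have non_arcs: "(a, c) \<notin> parcs G" "(a, d) \<notin> parcs G" "(a, e) \<notin> parcs G" "(a, f) \<notin> parcs G"
      "(b, d) \<notin> parcs G" "(b, e) \<notin> parcs G" "(b, f) \<notin> parcs G"
      "(c, e) \<notin> parcs G" "(c, f) \<notin> parcs G" "(d, f) \<notin> parcs G"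
      using path by (auto simp: dominates_def)
    have sym_not: "(y, x) \<notin> parcs G" if "(x, y) \<notin> parcs G" for x y
      using that sym by blast
    note arcs_rev = arcs[THEN sym] and non_arcs_rev = non_arcs[THEN sym_not]
    have loops: "(x, x) \<notin> parcs G" for x
      using no_loops' by blast
    have six: "{..<6} = {0, 1, 2, 3, 4, 5::nat}" by auto
    have "inj_on ?p {..<6}"
      using neq by (simp add: inj_on_nth)
    moreover have "?p ` {..<6} \<subseteq> pverts G"
      unfolding six using arcs in_arcsD1 in_arcsD2 by auto
    moreover have "\<forall>x\<in>{..<6}. \<forall>y\<in>{..<6}. (x, y) \<in> parcs (path_graph 6) \<longleftrightarrow> (?p x, ?p y) \<in> parcs G"
      unfolding six using arcs non_arcs loops by (simp add: path_graph_def arcs_rev non_arcs_rev)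
    ultimately have "\<not> induced_free (path_graph 6) G"
      using not_induced_free_iff[OF pair_wf_path_graph pair_wf_digraph_axioms, of 6]
      by (auto simp: path_graph_def)
    then show False using assms(2) by simp
  qed
qed

theorem theorem2:
  fixes G :: "'a pair_pre_digraph"
  assumes "pair_graph G"
    and "induced_free (path_graph 6) G"
    and "\<exists>D. efficient_dominating_set G D"
  shows "\<forall>k\<ge>5. induced_free (cycle_graph k) (square_graph G)"
proof (intro allI impI, rule ccontr)
  fix k :: nat
  assume k: "5 \<le> k" and "\<not> induced_free (cycle_graph k) (square_graph G)"
  then obtain v where inj: "inj_on v {..<k}" and v: "v ` {..<k} \<subseteq> pverts G"
    and arc: "\<And>x y. x < k \<Longrightarrow> y < k \<Longrightarrow>
      (x, y) \<in> parcs (cycle_graph k) \<longleftrightarrow> (v x, v y) \<in> parcs (square_graph G)"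
    unfolding not_induced_free_iff[OF pair_wf_cycle_graph pair_wf_square_graph]
    by (auto simp: cycle_graph_def square_graph_def)
  interpret pair_graph G by fact
  obtain D where "efficient_dominating_set G D"
    using assms(3) by blast
  moreover from this have "\<exists>d. (u \<in> pverts G \<longrightarrow> d \<in> D \<and> dominates G d u) \<and> (u \<notin> pverts G \<longrightarrow> d = u)" for u
    unfolding efficient_dominating_set_def by (cases "u \<in> pverts G") auto
  then obtain \<delta> where "\<And>u. u \<in> pverts G \<Longrightarrow> \<delta> u \<in> D \<and> dominates G (\<delta> u) u"
    "\<And>u. u \<notin> pverts G \<Longrightarrow> \<delta> u = u"
    by metis
  ultimately interpret P6_free_dominated "dominates G" \<delta>
    using P6_free_dominatedI assms(1,2) by blast
  \<comment> \<open>Distance 1 and distance 2 merge into a common closed neighbour; injectivity of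
    \<open>v\<close> turns distinct vertices into distinct indices.\<close>
  have arc_iff: "(v x, v y) \<in> parcs (square_graph G) \<longleftrightarrow> x \<noteq> y \<and> \<not> far (v x) (v y)"
    if "x < k" "y < k" for x y
  proof -
    have "v x \<in> pverts G" "v y \<in> pverts G" "v x = v y \<longleftrightarrow> x = y"
      using v inj that by (auto dest: inj_onD)
    then show ?thesis
      using graph_distance_1_2_iff[of "v x" "v y"]
      by (auto simp: square_graph_def far_def dominates_def)
  qed
  define w where "w i = v (i mod k)" for i
  have mod_neq: "a mod k \<noteq> b mod k" if "a < b" "b < a + k" for a b
    using that mod_eq_dvd_iff_nat[of a b k] dvd_imp_le[of k "b - a"] by auto
  show False
  proof (rule no_square_cycle[OF k])
    show "w (i + k) = w i" for i
      by (simp add: w_def)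
    show "\<exists>z. dominates G (w i) z \<and> dominates G z (w (i + 1))" for i
    proof -
      have "(i mod k, (i + 1) mod k) \<in> parcs (cycle_graph k)"
        using k by (simp add: cycle_graph_def mod_simps)
      then show ?thesis
        using arc arc_iff k by (auto simp: w_def far_def)
    qed
    show "far (w i) (w (i + d))" if d: "2 \<le> d" "d + 2 \<le> k" for i d
    proof -
      \<comment> \<open>The residues are distinct and not cyclically consecutive in either
        direction; the third inequality uses \<open>d + 2 \<le> k\<close>.\<close>
      have "i mod k \<noteq> (i + d) mod k" "(i + 1) mod k \<noteq> (i + d) mod k" "i mod k \<noteq> (i + d + 1) mod k"
        using d mod_neq[of i "i + d"] mod_neq[of "i + 1" "i + d"] mod_neq[of i "i + d + 1"]
        by simp_all
      moreover from this have "(i mod k, (i + d) mod k) \<notin> parcs (cycle_graph k)"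
        by (auto simp: cycle_graph_def mod_simps)
      ultimately show ?thesis
        using arc[of "i mod k" "(i + d) mod k"] arc_iff[of "i mod k" "(i + d) mod k"] k by (simp add: w_def)
    qed
  qed
qed

end
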